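(* Let $P\in\mathbb Q[X;\mathbb N]$ be a polynomial of degree $d-1$, $d\ge1$, admitting a Gotzmann development. Let $c_1\ge\dots\ge c_s\ge0$ be the Gotzmann coefficients of $P$, let $s_q=\#\{i\mid c_i\ge q-1\}$ for $q\ge1$, and let $e_0,\dots,e_{d-1}$ be the normalized Hilbert-Samuel coefficients of $P$. Then $$e_0=s_d,\qquad e_1=\binom{s_d+1}{2}-s_{d-1},\qquad e_2=\binom{s_d+1}{3}-\binom{s_{d-1}+1}{2}+s_{d-2},\ \dots,$$ $$e_{d-1}=\binom{s_d+1}{d}-\binom{s_{d-1}+1}{d-1}+\dots+(-1)^{d-2}\binom{s_2+1}{2}+(-1)^{d-1}s_1;$$ that is, for every $0\le i\le d-1$, $$e_i=\sum_{j=0}^{i-1}(-1)^j\binom{s_{d-j}+1}{i+1-j}+(-1)^i s_{d-i}.$$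
   Context: $\mathbb N$ includes $0$. $\mathbb Q[X;\mathbb N]=\{P\in\mathbb Q[X]\mid P(n)\in\mathbb N\text{ for }n\gg0\}$. For $i\ge 0$, $\binom{X+i}{i}=(X+i)(X+i-1)\cdots(X+1)/i!$. A nonzero $P\in\mathbb Q[X;\mathbb N]$ admits a Gotzmann development if there exist integers $c_1\ge\dots\ge c_s\ge0$ such that $P(n)=\binom{n+c_1}{c_1}+\binom{n+c_2-1}{c_2}+\dots+\binom{n+c_s-(s-1)}{c_s}$ for all $n\gg0$; these integers are uniquely determined by $P$ and are called its Gotzmann coefficients. The normalized Hilbert-Samuel coefficients of $P$ (of degree $d-1$) are the integers $e_0,\dots,e_{d-1}$ with $P(X)=\sum_{i=0}^{d-1}(-1)^i e_i\binom{X+d-1-i}{d-1-i}$. *)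

theory Defs
  imports "HOL-Computational_Algebra.Polynomial"
begin

definition eventually_nat_polys :: "rat poly set" where
  "eventually_nat_polys = {P. \<forall>\<^sub>F n in sequentially. poly P (of_nat n) \<in> \<nat>}"

definition binomial_poly :: "nat \<Rightarrow> rat poly" where
  "binomial_poly i = smult (1 / fact i) (\<Prod>k=1..i. [:of_nat k, 1:])"

text \<open>
  The list \<open>cs\<close> is indexed from 0, so \<open>cs ! k\<close> is the coefficient \<open>c\<^sub>k\<^sub>+\<^sub>1\<close> and
  the shift \<open>c\<^sub>i - (i - 1)\<close> becomes \<open>cs ! k - k\<close>. The upper argument is formed
  in the rationals to avoid truncated subtraction.
\<close>
definition gotzmann_development :: "rat poly \<Rightarrow> nat list \<Rightarrow> bool" where
  "gotzmann_development P cs \<longleftrightarrow>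
     P \<noteq> 0 \<and> sorted_wrt (\<ge>) cs \<and>
     (\<forall>\<^sub>F n in sequentially.
        poly P (of_nat n) =
          (\<Sum>k<length cs. (of_nat n + of_nat (cs ! k) - of_nat k) gchoose (cs ! k)))"

text \<open>The number of coefficients at least \<open>q - 1\<close>; meant for \<open>q \<ge> 1\<close> only.\<close>
definition gotzmann_count :: "nat list \<Rightarrow> nat \<Rightarrow> nat" where
  "gotzmann_count cs q = card {k. k < length cs \<and> cs ! k \<ge> q - 1}"

text \<open>
  With \<open>d = degree P + 1\<close>, only the values \<open>e 0, \<dots>, e (d - 1)\<close> are constrained.
\<close>
definition hilbert_samuel_coeffs :: "rat poly \<Rightarrow> (nat \<Rightarrow> int) \<Rightarrow> bool" where
  "hilbert_samuel_coeffs P e \<longleftrightarrow>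
     P = (\<Sum>i\<le>degree P. smult ((-1) ^ i * of_int (e i)) (binomial_poly (degree P - i)))"

end

theory Submission
  imports Defs "HOL-Computational_Algebra.Formal_Power_Series"
begin

text \<open>
  By Vandermonde, the \<open>k\<close>-th Gotzmann summand expands in the basis \<open>binomial_poly m\<close> with
  coefficients \<open>(-1)\<^bsup>c - m\<^esup> (k choose (c - m))\<close>, where \<open>c = cs ! k\<close>. Appending an entry \<open>c\<close> to a
  list of length \<open>n\<close> raises exactly the counts \<open>s\<^sub>q\<close> with \<open>q \<le> c + 1\<close>, from \<open>n\<close> to \<open>n + 1\<close>, so the
  total coefficient of \<open>binomial_poly m\<close> is obtained by induction on the list from the partial
  alternating sums of a row of Pascal's triangle. The coefficient at the largest entry is positive,
  hence no entry exceeds the degree, and the claim follows by comparing coefficients.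
\<close>

section \<open>Binomial polynomials as a basis\<close>

lemma poly_binomial_poly: "poly (binomial_poly m) x = (x + of_nat m) gchoose m"
proof -
  have "(\<Prod>k=1..m. of_nat k + x) = pochhammer (x + 1) m"
    unfolding pochhammer_prod
    by (rule prod.reindex_bij_witness[of _ "\<lambda>i. Suc i" "\<lambda>k. k - 1"]) (auto simp: algebra_simps)
  then show ?thesis
    by (simp add: binomial_poly_def poly_prod gbinomial_pochhammer')
qed

lemma degree_binomial_poly [simp]: "degree (binomial_poly m) = m"
proof -
  have "degree (\<Prod>k=1..m. [:of_nat k, 1 :: rat:]) = (\<Sum>k=1..m. degree [:of_nat k, 1 :: rat:])"
    by (rule degree_prod_sum_eq) simp
  then show ?thesis by (simp add: binomial_poly_def)
qed

lemma coeff_binomial_poly_self [simp]: "coeff (binomial_poly m) m \<noteq> 0"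
proof (cases m)
  case 0
  then show ?thesis by (simp add: binomial_poly_def)
next
  case (Suc n)
  then have "degree (binomial_poly m) \<noteq> 0" by simp
  then have "binomial_poly m \<noteq> 0" by (intro notI) (simp del: degree_binomial_poly)
  then show ?thesis using leading_coeff_neq_0[of "binomial_poly m"] by simp
qed

text \<open>The degrees are distinct, so only the last term reaches the top coefficient; descending
  from there kills every \<open>a m\<close>.\<close>

lemma binomial_poly_independent:
  assumes "(\<Sum>m\<le>N. smult (a m) (binomial_poly m)) = 0" and "m \<le> N"
  shows "a m = 0"
  using assms
proof (induction N)
  case 0
  then show ?case using coeff_binomial_poly_self[of 0] by (auto simp del: coeff_binomial_poly_self)
next
  case (Suc N)
  have "coeff (\<Sum>m\<le>N. smult (a m) (binomial_poly m)) (Suc N) = 0"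
    by (simp add: coeff_sum coeff_eq_0)
  with Suc.prems(1) have "a (Suc N) * coeff (binomial_poly (Suc N)) (Suc N) = 0"
    by (metis add_0 coeff_0 coeff_add coeff_smult sum.atMost_Suc)
  then have top: "a (Suc N) = 0" by simp
  show ?case
  proof (cases "m = Suc N")
    case False
    then show ?thesis using Suc top by simp
  qed (use top in simp)
qed

lemma binomial_poly_coeffs_unique:
  assumes "(\<Sum>m\<le>N. smult (a m) (binomial_poly m)) = (\<Sum>m\<le>N. smult (b m) (binomial_poly m))"
    and "m \<le> N"
  shows "a m = b m"
  using binomial_poly_independent[of "\<lambda>m. a m - b m" N m] assms
  by (simp add: smult_diff_left sum_subtractf)

text \<open>In characteristic zero the large naturals are infinitely many roots of the
  difference.\<close>

lemma poly_eqI_eventually: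
  fixes p q :: "'a::{idom, ring_char_0} poly"
  assumes "\<forall>\<^sub>F n in sequentially. poly p (of_nat n) = poly q (of_nat n)"
  shows "p = q"
proof (rule ccontr)
  assume "p \<noteq> q"
  then have "finite {x. poly (p - q) x = 0}" by (intro poly_roots_finite) simp
  moreover obtain N where "\<forall>n\<ge>N. poly p (of_nat n) = poly q (of_nat n)"
    using assms by (auto simp: eventually_sequentially)
  then have "of_nat ` {N..} \<subseteq> {x. poly (p - q) x = 0}" by auto
  ultimately have "finite ((of_nat :: nat \<Rightarrow> 'a) ` {N..})" using finite_subset by blast
  then show False
    by (simp add: finite_image_iff inj_on_def infinite_Ici)
qed

section \<open>Expansion of a Gotzmann development in this basis\<close>

lemma gbinomial_shift_expansion:
  fixes x :: "'a::field_char_0"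
  shows "(x + of_nat c - of_nat k) gchoose c =
    (\<Sum>m\<le>c. (-1) ^ (c - m) * of_nat (k choose (c - m)) * ((x + of_nat m) gchoose m))"
proof -
  \<comment> \<open>Upper negation turns the argument into \<open>(- x - 1) + k\<close>, which
    Vandermonde splits; negating each \<open>(- x - 1) gchoose m\<close> back gives the basis
    values.\<close>
  have "(x + of_nat c - of_nat k) gchoose c = (-1) ^ c * ((- x - 1 + of_nat k) gchoose c)"
    using gbinomial_negated_upper[of "x + of_nat c - of_nat k" c] by (simp add: algebra_simps)
  also have "(- x - 1 + of_nat k) gchoose c =
      (\<Sum>m\<le>c. ((- x - 1) gchoose m) * (of_nat k gchoose (c - m)))"
    unfolding atMost_atLeast0 by (rule gbinomial_Vandermonde[symmetric])
  also have "(-1) ^ c * \<dots> =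
      (\<Sum>m\<le>c. (-1) ^ (c - m) * of_nat (k choose (c - m)) * ((x + of_nat m) gchoose m))"
    unfolding sum_distrib_left
  proof (rule sum.cong[OF refl])
    fix m assume "m \<in> {..c}"
    then have sgn: "(-1) ^ c * (-1) ^ m = ((-1) ^ (c - m) :: 'a)"
      by (auto simp: minus_one_power_iff)
    have "(- x - 1) gchoose m = (-1) ^ m * ((x + of_nat m) gchoose m)"
      using gbinomial_negated_upper[of "- x - 1" m] by (simp add: add_ac)
    then show "(-1) ^ c * (((- x - 1) gchoose m) * (of_nat k gchoose (c - m))) =
        (-1) ^ (c - m) * of_nat (k choose (c - m)) * ((x + of_nat m) gchoose m)"
      unfolding sgn[symmetric] binomial_gbinomial by (simp only: mult_ac)
  qed
  finally show ?thesis .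
qed

text \<open>The guard matters: truncated subtraction would otherwise let an entry below
  \<open>m\<close> contribute 1.\<close>

definition gotzmann_basis_coeff :: "nat list \<Rightarrow> nat \<Rightarrow> int" where
  "gotzmann_basis_coeff cs m =
     (\<Sum>k<length cs. if m \<le> cs ! k then (-1) ^ (cs ! k - m) * int (k choose (cs ! k - m)) else 0)"

text \<open>The bound \<open>N\<close> is left free because it is applied before the entries are
  known not to exceed the degree.\<close>

lemma gotzmann_development_expansion:
  assumes "gotzmann_development P cs" and "\<forall>c\<in>set cs. c \<le> N"
  shows "P = (\<Sum>m\<le>N. smult (of_int (gotzmann_basis_coeff cs m)) (binomial_poly m))"
proof (rule poly_eqI_eventually)
  have "(\<Sum>k<length cs. (x + of_nat (cs ! k) - of_nat k) gchoose (cs ! k)) =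
      poly (\<Sum>m\<le>N. smult (of_int (gotzmann_basis_coeff cs m)) (binomial_poly m)) x" for x :: rat
  proof -
    have "(x + of_nat (cs ! k) - of_nat k) gchoose (cs ! k) =
        (\<Sum>m\<le>N. of_int (if m \<le> cs ! k then (-1) ^ (cs ! k - m) * int (k choose (cs ! k - m)) else 0)
          * ((x + of_nat m) gchoose m))" if "k < length cs" for k
      unfolding gbinomial_shift_expansion
      by (rule sum.mono_neutral_cong_left) (use that assms(2) nth_mem[OF that] in auto)
    then have "(\<Sum>k<length cs. (x + of_nat (cs ! k) - of_nat k) gchoose (cs ! k)) =
        (\<Sum>k<length cs. \<Sum>m\<le>N.
          of_int (if m \<le> cs ! k then (-1) ^ (cs ! k - m) * int (k choose (cs ! k - m)) else 0)
          * ((x + of_nat m) gchoose m))"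
      by simp
    also have "\<dots> = (\<Sum>m\<le>N. of_int (gotzmann_basis_coeff cs m) * ((x + of_nat m) gchoose m))"
      unfolding gotzmann_basis_coeff_def of_int_sum sum_distrib_right by (rule sum.swap)
    finally show ?thesis by (simp add: poly_sum poly_binomial_poly)
  qed
  then show "\<forall>\<^sub>F n in sequentially. poly P (of_nat n) =
      poly (\<Sum>m\<le>N. smult (of_int (gotzmann_basis_coeff cs m)) (binomial_poly m)) (of_nat n)"
    using assms(1) by (simp add: gotzmann_development_def)
qed

section \<open>Basis coefficients in terms of the counts\<close>

lemma gotzmann_count_snoc:
  "gotzmann_count (cs @ [c]) q = gotzmann_count cs q + (if q - 1 \<le> c then 1 else 0)"
proof -
  have "{k. k < length (cs @ [c]) \<and> (cs @ [c]) ! k \<ge> q - 1} =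
      {k. k < length cs \<and> cs ! k \<ge> q - 1} \<union> (if q - 1 \<le> c then {length cs} else {})"
    by (auto simp: nth_append less_Suc_eq)
  then show ?thesis by (simp add: gotzmann_count_def card_insert_if)
qed

lemma gotzmann_count_eq_length:
  assumes "\<forall>c\<in>set cs. q - 1 \<le> c"
  shows "gotzmann_count cs q = length cs"
proof -
  have "{k. k < length cs \<and> cs ! k \<ge> q - 1} = {..<length cs}" using assms by auto
  then show ?thesis by (simp add: gotzmann_count_def)
qed

lemma gotzmann_basis_coeff_snoc:
  "gotzmann_basis_coeff (cs @ [c]) m = gotzmann_basis_coeff cs m +
     (if m \<le> c then (-1) ^ (c - m) * int (length cs choose (c - m)) else 0)"
proof -
  let ?f = "\<lambda>cs k. if m \<le> cs ! k
    then (-1) ^ (cs ! k - m) * int (k choose (cs ! k - m)) else 0"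
  have "(cs @ [c]) ! k = cs ! k" if "k < length cs" for k
    using that by (simp add: nth_append)
  then have "(\<Sum>k<length cs. ?f (cs @ [c]) k) = (\<Sum>k<length cs. ?f cs k)"
    by (intro sum.cong) simp_all
  then show ?thesis by (simp add: gotzmann_basis_coeff_def)
qed

text \<open>Pascal's rule splits each entry of row \<open>Suc n\<close> into two neighbours of row
  \<open>n\<close>, and the alternating sum telescopes.\<close>

lemma alternating_binomial_partial_sum:
  "(\<Sum>r\<le>t. (-1) ^ r * int (Suc n choose r)) = (-1) ^ t * int (n choose t)"
  by (induction t) (auto simp: algebra_simps)

text \<open>
  The summand at \<open>r = 0\<close> is \<open>s\<^bsub>m+1\<^esub> + 1\<close>, which the trailing \<open>- 1\<close> corrects to \<open>s\<^bsub>m+1\<^esub>\<close>.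
\<close>
lemma gotzmann_basis_coeff_eq:
  assumes "sorted_wrt (\<ge>) cs" and "\<forall>c\<in>set cs. c < d" and "m < d"
  shows "gotzmann_basis_coeff cs m =
    (\<Sum>r<d - m. (-1) ^ r * int ((gotzmann_count cs (m + 1 + r) + 1) choose (r + 1))) - 1"
  using assms
\<comment> \<open>Induction from the right, since a prefix keeps its positions and hence its
  shifts.\<close>
proof (induction cs rule: rev_induct)
  case Nil
  \<comment> \<open>All counts are 0, so only \<open>r = 0\<close> survives; its value 1 cancels the
    trailing \<open>- 1\<close>.\<close>
  have "{..<d - m} = insert 0 {1..<d - m}" using Nil by auto
  then show ?case by (simp add: gotzmann_basis_coeff_def gotzmann_count_def binomial_eq_0)
next
  case (snoc c cs)
  let ?t = "\<lambda>cs r. (-1) ^ r * int ((gotzmann_count cs (m + 1 + r) + 1) choose (r + 1))"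
  \<comment> \<open>By the descending order all earlier entries are at least \<open>c\<close>, so an
    affected count rises from \<open>length cs\<close> to \<open>length cs + 1\<close>; Pascal's
    rule gives the increment.\<close>
  have step: "?t (cs @ [c]) r = ?t cs r +
      (if m + r \<le> c then (-1) ^ r * int (Suc (length cs) choose r) else 0)" for r
  proof (cases "m + r \<le> c")
    case True
    then have "gotzmann_count cs (m + 1 + r) = length cs"
      using snoc.prems(1) by (intro gotzmann_count_eq_length) (auto simp: sorted_wrt_append)
    with True show ?thesis by (simp add: gotzmann_count_snoc algebra_simps)
  qed (simp add: gotzmann_count_snoc)
  \<comment> \<open>As \<open>c < d\<close>, the range contains every \<open>r\<close> up to
    \<open>c - m\<close>, so a full partial row sum remains.\<close>
  have "(\<Sum>r<d - m. if m + r \<le> c then (-1) ^ r * int (Suc (length cs) choose r) else 0) =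
      (if m \<le> c then (-1) ^ (c - m) * int (length cs choose (c - m)) else 0)"
  proof (cases "m \<le> c")
    case True
    have "(\<Sum>r<d - m. if m + r \<le> c then (-1) ^ r * int (Suc (length cs) choose r) else 0) =
        (\<Sum>r\<le>c - m. (-1) ^ r * int (Suc (length cs) choose r))"
      by (rule sum.mono_neutral_cong_right) (use True snoc.prems in auto)
    with True show ?thesis by (simp only: alternating_binomial_partial_sum if_True)
  qed simp
  moreover have "gotzmann_basis_coeff cs m = (\<Sum>r<d - m. ?t cs r) - 1"
    using snoc by (simp add: sorted_wrt_append)
  ultimately show ?case
    unfolding step sum.distrib gotzmann_basis_coeff_snoc by simp
qed

text \<open>At the maximum only entries equal to \<open>M\<close> contribute, each with
  \<open>k choose 0 = 1\<close>.\<close>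

lemma gotzmann_basis_coeff_max_pos:
  assumes "\<forall>c\<in>set cs. c \<le> M" and "M \<in> set cs"
  shows "gotzmann_basis_coeff cs M > 0"
proof -
  obtain k where k: "k < length cs" "cs ! k = M" using assms(2) by (auto simp: in_set_conv_nth)
  have eq: "cs ! j = M" if "j < length cs" "M \<le> cs ! j" for j
    using assms(1) that nth_mem[OF that(1)] by fastforce
  show ?thesis unfolding gotzmann_basis_coeff_def
    by (rule sum_pos2[of _ k]) (use k eq in auto)
qed

theorem proposition3p11:
  fixes P :: "rat poly" and d :: nat and cs :: "nat list" and e :: "nat \<Rightarrow> int"
  assumes "P \<in> eventually_nat_polys"
    and "d \<ge> 1"
    and "P \<noteq> 0"
    and "degree P = d - 1"
    and "gotzmann_development P cs"
    and "hilbert_samuel_coeffs P e"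
  shows "\<forall>i\<le>d - 1.
    e i = (\<Sum>j<i. (-1) ^ j * int ((gotzmann_count cs (d - j) + 1) choose (i + 1 - j)))
          + (-1) ^ i * int (gotzmann_count cs (d - i))"
proof -
  \<comment> \<open>A common range for both expansions; \<open>b\<close> reindexes the signed
    \<open>e i\<close> by the degree \<open>m = d - 1 - i\<close> and is padded with 0 above the
    degree of \<open>P\<close>.\<close>
  define N where "N = Max (insert (d - 1) (set cs))"
  define b where "b m = (if m \<le> d - 1 then (-1) ^ (d - 1 - m) * e (d - 1 - m) else 0)" for m
  have N_ge: "d - 1 \<le> N" "\<forall>c\<in>set cs. c \<le> N" by (simp_all add: N_def)
  have cancel: "d - Suc (d - Suc i) = i" if "i \<le> d - Suc 0" for i
    using assms(2) that by arith
  have "P = (\<Sum>i\<le>d - 1. smult ((-1) ^ i * of_int (e i)) (binomial_poly (d - 1 - i)))"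
    using assms(4,6) by (simp add: hilbert_samuel_coeffs_def)
  also have "\<dots> = (\<Sum>m\<le>d - 1. smult (of_int (b m)) (binomial_poly m))"
    by (rule sum.reindex_bij_witness[of _ "\<lambda>m. d - 1 - m" "\<lambda>i. d - 1 - i"])
      (auto simp: b_def cancel)
  also have "\<dots> = (\<Sum>m\<le>N. smult (of_int (b m)) (binomial_poly m))"
    by (rule sum.mono_neutral_left) (use N_ge in \<open>auto simp: b_def\<close>)
  finally have "P = (\<Sum>m\<le>N. smult (of_int (b m)) (binomial_poly m))" .
  moreover have "P = (\<Sum>m\<le>N. smult (of_int (gotzmann_basis_coeff cs m)) (binomial_poly m))"
    by (rule gotzmann_development_expansion[OF assms(5) N_ge(2)])
  ultimately have "(\<Sum>m\<le>N. smult (of_int (gotzmann_basis_coeff cs m)) (binomial_poly m)) =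
      (\<Sum>m\<le>N. smult (of_int (b m)) (binomial_poly m))" by simp
  from binomial_poly_coeffs_unique[OF this]
  have coeff_eq: "gotzmann_basis_coeff cs m = b m" if "m \<le> N" for m
    using that by simp
  \<comment> \<open>Otherwise \<open>N\<close> would be the largest entry, with a positive
    coefficient, while \<open>b N = 0\<close>.\<close>
  have "N = d - 1"
  proof (rule ccontr)
    assume "N \<noteq> d - 1"
    moreover have "N \<in> insert (d - 1) (set cs)" unfolding N_def by (rule Max_in) auto
    ultimately have "N \<in> set cs" by blast
    then have "gotzmann_basis_coeff cs N > 0" by (intro gotzmann_basis_coeff_max_pos N_ge)
    moreover have "d - 1 < N" using \<open>N \<noteq> d - 1\<close> N_ge(1) by simp
    ultimately show False using coeff_eq[of N] by (simp add: b_def)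
  qed
  then have "c \<le> d - 1" if "c \<in> set cs" for c
    using N_ge(2) that by simp
  then have bound: "\<forall>c\<in>set cs. c < d" using assms(2) by fastforce
  have sorted: "sorted_wrt (\<ge>) cs" using assms(5) by (simp add: gotzmann_development_def)
  show ?thesis
  proof (intro allI impI)
    fix i assume i: "i \<le> d - 1"
    let ?u = "\<lambda>j. int ((gotzmann_count cs (d - j) + 1) choose (i + 1 - j))"
    have "(-1) ^ i * e i = gotzmann_basis_coeff cs (d - 1 - i)"
      using coeff_eq[of "d - 1 - i"] \<open>N = d - 1\<close> i by (simp add: b_def cancel)
    also have "\<dots> = (\<Sum>r<Suc i. (-1) ^ r * int ((gotzmann_count cs (d - i + r) + 1) choose (r + 1))) - 1"
    proof -
      have "d - (d - 1 - i) = Suc i" "d - 1 - i + 1 = d - i" "d - 1 - i < d"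
        using assms(2) i by auto
      then show ?thesis
        using gotzmann_basis_coeff_eq[OF sorted bound, of "d - 1 - i"] by (simp only:)
    qed
    \<comment> \<open>Reversal of the sum by \<open>j = i - r\<close>. The term \<open>j = i\<close>
      becomes \<open>gotzmann_count cs (d - i) + 1\<close>, whose excess 1 the \<open>- 1\<close>
      removes.\<close>
    also have "(\<Sum>r<Suc i. (-1) ^ r * int ((gotzmann_count cs (d - i + r) + 1) choose (r + 1))) =
        (\<Sum>j<Suc i. (-1) ^ (i - j) * ?u j)"
      by (rule sum.reindex_bij_witness[of _ "\<lambda>j. i - j" "\<lambda>r. i - r"]) (use i in \<open>auto simp: Suc_diff_le\<close>)
    finally have "(-1) ^ i * e i = (\<Sum>j<i. (-1) ^ (i - j) * ?u j) + int (gotzmann_count cs (d - i))"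
      by simp
    \<comment> \<open>The sign \<open>(-1) ^ i\<close> squares to 1 and turns
      \<open>(-1) ^ (i - j)\<close> into \<open>(-1) ^ j\<close>.\<close>
    then have "(-1) ^ i * ((-1) ^ i * e i) =
        (-1) ^ i * ((\<Sum>j<i. (-1) ^ (i - j) * ?u j) + int (gotzmann_count cs (d - i)))"
      by simp
    moreover have "(-1) ^ i * (\<Sum>j<i. (-1) ^ (i - j) * ?u j) = (\<Sum>j<i. (-1) ^ j * ?u j)"
      unfolding sum_distrib_left
      by (rule sum.cong) (auto simp: minus_one_power_iff)
    ultimately show "e i = (\<Sum>j<i. (-1) ^ j * ?u j) + (-1) ^ i * int (gotzmann_count cs (d - i))"
      by (simp add: distrib_left flip: mult.assoc power_add mult_2)
  qed
qed

end
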